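(* Let $q\ge 2$ be an integer, $\Lambda=\{0,1,\dots,q-1\}$, and let $T:I^d\to I^d$ be a product of expansive Markov maps that is conjugate to the full shift on the $q$ symbols of $\Lambda$. Fix $n\geq 1$ and let $n\leq m<(n-1)+\dfrac{(n-1)\ln(q-1)}{\ln(q)-\ln(q-1)}$. Let $\rho_{m,n}$ denote the escape rate of $T$ into a hole that corresponds to the union of the cylinders based at $q^{m-n}$ words of length $m$ with property (P), and let $\rho_{m+1,n}$ denote the escape rate of $T$ into a hole that corresponds to the union of the cylinders based at $q^{m+1-n}$ words of length $m+1$ with property (P). Then $$\rho_{m,n}<\rho_{m+1,n}.$$
   Context: Expansive Markov map: $I$ is a closed interval with a Markov partition $\{I_0,\dots,I_{N-1}\}$ (closed intervals with union $I$ and pairwise disjoint interiors); $f:I\to I$ is such that for all $i,j$ either $f(\mathrm{int}\,I_i)\cap \mathrm{int}\,I_j=\emptyset$ or $\mathrm{int}\,I_j\subseteq f(\mathrm{int}\,I_i)$, $f$ is smooth on each $\mathrm{int}(I_i)$, and there is $\lambda>1$ with $|f'|\ge\lambda$ on each $\mathrm{int}(I_i)$. A product of such maps $f_1,\dots,f_d$ is $T(x_1,\dots,x_d)=(f_1(x_1),\dots,f_d(x_d))$ on $I^d$. Full shift: $\Sigma_q^+=\Lambda^{\mathbb N}$ with left shift $\sigma$. For a word $w$, the cylinder $C_w$ is the set of sequences in $\Sigma_q^+$ beginning with $w$. $\Sigma_q^+$ carries the $\sigma$-invariant probability measure $\mu$ with $\mu(C_w)=q^{-|w|}$ for every word $w$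 of length $|w|$. "$T$ is conjugate to the full shift" means that, with respect to the measure $\tilde\mu$ on $I^d$ induced from $\mu$ by the coding map $\pi:\Sigma_q^+\to I^d$, $\pi$ is a metric conjugacy (a measure-preserving bijection off null sets, with $\pi\circ\sigma=T\circ\pi$). The hole corresponding to a union of cylinders is the subset of $I^d$ corresponding to that union under $\pi$. Escape rate: for a measure-preserving map $T$ on a probability space $(X,\mathcal B,\nu)$ and a hole $A\in\mathcal B$ with $\nu(A)>0$, $\rho(A)=-\lim_{h\to\infty}\frac1h\ln\nu(X\setminus\Omega_h(A))$ (when the limit exists), where $\Omega_h(A)=\bigcup_{j=0}^h T^{-j}(A)$. The escape rate is invariant under metric conjugacy, so it may be computed for $(\Sigma_q^+,\sigma,\mu)$ and the corresponding union of cylinders. Correlation polynomial: for words $u,w$ with $u$ of length $n_1$, place a copy of $w$ under $u$ shifted to the right by $\ell$ positions, $0\le \ell\le n_1-1$; set $b_{\ell+1}=1$ if the overlapping parts agree and $b_{\ell+1}=0$ otherwise. Then $(uw)_z=b_1z^{n_1-1}+b_2z^{n_1-2}+\dots+b_{n_1}$. Property (P) for a collection of words $w_1,\dots,w_k$ all of the same length $\ell$: $(w_iw_i)_z=z^{\ell-1}$ for every $i$ and $(w_iw_j)_z=0$ for all $i\ne j$. It is a standing assumption that collections with property (P) of the required sizes exist; the escape rate into the corresponding hole depends only on $q$, the common word length and the number of words, not on the choice of the collection with property (P). *)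

theory Defs
  imports "HOL-Probability.Probability" "HOL-Computational_Algebra.Polynomial"
begin

subsection \<open>Expansive Markov maps and their products\<close>

definition smooth_on_open :: "real set \<Rightarrow> (real \<Rightarrow> real) \<Rightarrow> bool" where
  "smooth_on_open S f \<longleftrightarrow> open S \<and> (\<forall>k. ((deriv ^^ k) f) differentiable_on S)"

text \<open>The interval is \<open>{a..b}\<close> and the Markov partition is \<open>P 0, \<dots>, P (N - 1)\<close>. The values of
  \<open>f\<close> at the end points of the partition intervals are arbitrary points of \<open>{a..b}\<close>.\<close>

definition expansive_markov_map ::
    "real \<Rightarrow> real \<Rightarrow> nat \<Rightarrow> (nat \<Rightarrow> real set) \<Rightarrow> (real \<Rightarrow> real) \<Rightarrow> bool" where
  "expansive_markov_map a b N P f \<longleftrightarrow>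
     a < b \<and>
     (\<forall>i<N. \<exists>c d. c < d \<and> P i = {c..d}) \<and>
     (\<Union>i<N. P i) = {a..b} \<and>
     (\<forall>i<N. \<forall>j<N. i \<noteq> j \<longrightarrow> interior (P i) \<inter> interior (P j) = {}) \<and>
     f ` {a..b} \<subseteq> {a..b} \<and>
     (\<forall>i<N. \<forall>j<N. f ` interior (P i) \<inter> interior (P j) = {} \<or>
                  interior (P j) \<subseteq> f ` interior (P i)) \<and>
     (\<forall>i<N. smooth_on_open (interior (P i)) f) \<and>
     (\<exists>l>1. \<forall>i<N. \<forall>x\<in>interior (P i). l \<le> \<bar>deriv f x\<bar>)"

definition cube :: "real \<Rightarrow> real \<Rightarrow> (real ^ 'd) set" where
  "cube a b = {x. \<forall>i. x $ i \<in> {a..b}}"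

definition product_map :: "('d \<Rightarrow> real \<Rightarrow> real) \<Rightarrow> real ^ 'd \<Rightarrow> real ^ 'd" where
  "product_map f x = (\<chi> i. f i (x $ i))"

text \<open>The product partition consists of the boxes \<open>\<Prod>\<^sub>i P i (c i)\<close>, one for every choice \<open>c\<close> of a
  partition element in each coordinate.\<close>

definition product_rectangle :: "('d \<Rightarrow> nat \<Rightarrow> real set) \<Rightarrow> ('d \<Rightarrow> nat) \<Rightarrow> (real ^ 'd) set" where
  "product_rectangle P c = {x. \<forall>i. x $ i \<in> P i (c i)}"

subsection \<open>The full shift\<close>

definition full_shift :: "nat \<Rightarrow> (nat \<Rightarrow> nat) measure" where
  "full_shift q = Pi\<^sub>M UNIV (\<lambda>_. uniform_count_measure {..<q})"

definition left_shift :: "(nat \<Rightarrow> nat) \<Rightarrow> nat \<Rightarrow> nat" where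
  "left_shift s = (\<lambda>n. s (Suc n))"

definition cylinder :: "nat \<Rightarrow> nat list \<Rightarrow> (nat \<Rightarrow> nat) set" where
  "cylinder q w = {s. (\<forall>n. s n < q) \<and> (\<forall>i<length w. s i = w ! i)}"

lemma space_full_shift: "space (full_shift q) = {s. \<forall>n. s n < q}"
  by (auto simp: full_shift_def space_PiM PiE_def Pi_def space_uniform_count_measure)

lemma measure_cylinder:
  assumes "q \<ge> 1" "set w \<subseteq> {..<q}"
  shows "measure (full_shift q) (cylinder q w) = 1 / real q ^ length w"
proof -
  have ps: "prob_space (uniform_count_measure {..<q})"
    using assms(1) by (intro prob_space_uniform_count_measure) (auto simp: lessThan_empty_iff)
  interpret product_prob_space "\<lambda>_::nat. uniform_count_measure {..<q}" UNIV
    unfolding product_prob_space_def product_prob_space_axioms_def product_sigma_finite_def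
    using ps prob_space_imp_sigma_finite by auto
  have w: "w ! i < q" if "i < length w" for i
    using that assms(2) nth_mem by blast
  have "cylinder q w = prod_emb UNIV (\<lambda>_. uniform_count_measure {..<q}) {..<length w}
                         (Pi\<^sub>E {..<length w} (\<lambda>i. {w ! i}))"
    by (auto simp: cylinder_def prod_emb_def space_uniform_count_measure PiE_iff restrict_def
             split: if_splits)
  then show ?thesis
    unfolding full_shift_def
    using measure_PiM_emb[of "{..<length w}" "\<lambda>i. {w ! i}"] w
    by (simp add: sets_uniform_count_measure measure_uniform_count_measure power_one_over)
qed

subsection \<open>Coding and metric conjugacy\<close>

text \<open>\<open>R s\<close> is the partition rectangle labelled by the symbol \<open>s\<close>. The point coded by a sequence is
  obtained from closures of sets of points with prescribed finite itinerary through the interiors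
  of the rectangles, since \<open>T\<close> need not be continuous on their boundaries.\<close>

definition is_coding_map ::
    "nat \<Rightarrow> 'x::topological_space set \<Rightarrow> (nat \<Rightarrow> 'x set) \<Rightarrow> ('x \<Rightarrow> 'x) \<Rightarrow> ((nat \<Rightarrow> nat) \<Rightarrow> 'x) \<Rightarrow> bool" where
  "is_coding_map q X R T \<pi> \<longleftrightarrow>
     (\<forall>s\<in>space (full_shift q).
        (\<Inter>n. closure {x \<in> X. \<forall>j\<le>n. (T ^^ j) x \<in> interior (R (s j))}) = {\<pi> s})"

definition induced_measure ::
    "nat \<Rightarrow> 'x::topological_space set \<Rightarrow> ((nat \<Rightarrow> nat) \<Rightarrow> 'x) \<Rightarrow> 'x measure" where
  "induced_measure q X \<pi> = distr (full_shift q) (restrict_space borel X) \<pi>"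

definition measure_preserving :: "'x measure \<Rightarrow> 'y measure \<Rightarrow> ('x \<Rightarrow> 'y) \<Rightarrow> bool" where
  "measure_preserving M N g \<longleftrightarrow> g \<in> M \<rightarrow>\<^sub>M N \<and> distr M N g = N"

definition metric_conjugacy ::
    "'x measure \<Rightarrow> ('x \<Rightarrow> 'x) \<Rightarrow> 'y measure \<Rightarrow> ('y \<Rightarrow> 'y) \<Rightarrow> ('x \<Rightarrow> 'y) \<Rightarrow> bool" where
  "metric_conjugacy M S N T \<pi> \<longleftrightarrow>
     measure_preserving M M S \<and> measure_preserving N N T \<and> measure_preserving M N \<pi> \<and>
     (\<exists>X Y. X \<in> sets M \<and> emeasure M (space M - X) = 0 \<and> S ` X \<subseteq> X \<and>
            Y \<in> sets N \<and> emeasure N (space N - Y) = 0 \<and> T ` Y \<subseteq> Y \<and>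
            bij_betw \<pi> X Y \<and>
            the_inv_into X \<pi> \<in> restrict_space N Y \<rightarrow>\<^sub>M restrict_space M X \<and>
            (\<forall>x\<in>X. \<pi> (S x) = T (\<pi> x)))"

definition conjugate_to_full_shift ::
    "nat \<Rightarrow> 'x::topological_space set \<Rightarrow> (nat \<Rightarrow> 'x set) \<Rightarrow> ('x \<Rightarrow> 'x) \<Rightarrow> ((nat \<Rightarrow> nat) \<Rightarrow> 'x) \<Rightarrow> bool" where
  "conjugate_to_full_shift q X R T \<pi> \<longleftrightarrow>
     is_coding_map q X R T \<pi> \<and>
     metric_conjugacy (full_shift q) left_shift (induced_measure q X \<pi>) T \<pi>"

text \<open>As \<open>\<pi>\<close> is a bijection only off null sets, a set of sequences determines the corresponding
  subset of the phase space only up to a null set; every measurable representative is allowed.\<close>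

definition corresponds_under ::
    "('x \<Rightarrow> 'y) \<Rightarrow> 'x measure \<Rightarrow> 'y measure \<Rightarrow> 'x set \<Rightarrow> 'y set \<Rightarrow> bool" where
  "corresponds_under \<pi> M N H A \<longleftrightarrow>
     H \<in> sets M \<and> A \<in> sets N \<and> (AE x in M. x \<in> H \<longleftrightarrow> \<pi> x \<in> A)"

subsection \<open>Escape rates\<close>

definition escape_set :: "'x measure \<Rightarrow> ('x \<Rightarrow> 'x) \<Rightarrow> 'x set \<Rightarrow> nat \<Rightarrow> 'x set" where
  "escape_set M T A h = (\<Union>j\<le>h. (T ^^ j) -` A \<inter> space M)"

text \<open>\<open>r\<close> is the (finite) escape rate into \<open>A\<close>. The positivity of the surviving measure is required
  because \<open>ln 0 = 0\<close> in HOL.\<close>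

definition has_escape_rate :: "'x measure \<Rightarrow> ('x \<Rightarrow> 'x) \<Rightarrow> 'x set \<Rightarrow> real \<Rightarrow> bool" where
  "has_escape_rate M T A r \<longleftrightarrow>
     A \<in> sets M \<and> measure M A > 0 \<and>
     (\<forall>h. measure M (space M - escape_set M T A h) > 0) \<and>
     (\<lambda>h. - (ln (measure M (space M - escape_set M T A h)) / real h)) \<longlonglongrightarrow> r"

subsection \<open>Correlation polynomials\<close>

text \<open>The overlap of \<open>u\<close> with a copy of \<open>w\<close> shifted right by \<open>l\<close> consists of the positions \<open>i\<close> of \<open>w\<close>
  with \<open>i < length w\<close> and \<open>l + i < length u\<close>.\<close>

definition overlap_agrees :: "'a list \<Rightarrow> 'a list \<Rightarrow> nat \<Rightarrow> bool" where
  "overlap_agrees u w l \<longleftrightarrow> (\<forall>i. i < length w \<and> l + i < length u \<longrightarrow> u ! (l + i) = w ! i)"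

definition correlation_poly :: "'a list \<Rightarrow> 'a list \<Rightarrow> int poly" where
  "correlation_poly u w =
     (\<Sum>l<length u. monom (if overlap_agrees u w l then 1 else 0) (length u - 1 - l))"

definition property_P :: "nat \<Rightarrow> 'a list set \<Rightarrow> bool" where
  "property_P k W \<longleftrightarrow>
     (\<forall>w\<in>W. length w = k) \<and>
     (\<forall>w\<in>W. correlation_poly w w = monom 1 (k - 1)) \<and>
     (\<forall>u\<in>W. \<forall>w\<in>W. u \<noteq> w \<longrightarrow> correlation_poly u w = 0)"

end

theory Submission
  imports Defs
begin

text \<open>
  The escape rate is transported to the full shift by the conjugacy
  (\<open>has_escape_rate_conjugacy\<close>). There the points that have not fallen into the hole are the
  sequences with a long prefix free of the words of \<open>W\<close>. Property (P) says that occurrences of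
  words of \<open>W\<close> never overlap, so the number \<open>a\<^sub>h\<close> of words of length \<open>h\<close> that avoid a set \<open>W\<close> of
  words of length \<open>k\<close> satisfies \<open>a\<^sub>h\<^sub>+\<^sub>k + card W * a\<^sub>h = q * a\<^sub>h\<^sub>+\<^sub>k\<^sub>-\<^sub>1\<close> (\<open>card_avoiding_recurrence\<close>).
  For the probabilities \<open>p\<^sub>h = a\<^sub>h / q ^ h\<close> and \<open>card W = q ^ (k - n)\<close> the characteristic equation of
  the recurrence is \<open>t ^ (k - 1) * (1 - t) = 1 / q ^ n\<close>. If \<open>t\<close> is a root to the right of
  the point \<open>(k - 1) / k\<close> where the left side is maximal, then \<open>p\<^sub>h\<close> lies between two constant
  multiples of \<open>t ^ h\<close> (\<open>recurrence_lower\<close>, \<open>recurrence_upper\<close>), hence the escape rate is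
  \<open>- ln t\<close> (\<open>escape_rate_full_shift\<close>).

  The bound on \<open>m\<close> says precisely that \<open>t ^ m * (1 - t) > 1 / q ^ n\<close> at \<open>t = 1 - 1 / q\<close>. This
  provides such roots \<open>t\<close> for \<open>k = m\<close> and \<open>t'\<close> for \<open>k = m + 1\<close>. As \<open>t' < 1\<close>, replacing the exponent
  \<open>m\<close> by \<open>m - 1\<close> makes the left side exceed \<open>1 / q ^ n\<close> at \<open>t'\<close>; since
  \<open>t ^ (m - 1) * (1 - t)\<close> decreases to the right of \<open>(m - 1) / m\<close>, this forces \<open>t' < t\<close>.
\<close>

section \<open>Invariance of the escape rate under metric conjugacy\<close>

lemma measure_preserving_funpow:
  assumes "measure_preserving M M S"
  shows "measure_preserving M M (S ^^ j)"
proof (induction j)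
  case 0
  have "distr M M (\<lambda>x. x) = M"
    by (rule distr_id2) simp
  then show ?case
    by (simp add: measure_preserving_def id_def)
next
  case (Suc j)
  then have "distr M M (S \<circ> (S ^^ j)) = M"
    using assms distr_distr[of S M M "S ^^ j" M] by (simp add: measure_preserving_def)
  then show ?case
    using Suc assms by (auto simp: measure_preserving_def comp_def)
qed

lemma escape_set_measurable:
  assumes "measure_preserving M M S" "H \<in> sets M"
  shows "escape_set M S H h \<in> sets M"
proof -
  have "(S ^^ j) -` H \<inter> space M \<in> sets M" for j
    using measure_preserving_funpow[OF assms(1)] assms(2)
    by (auto simp: measure_preserving_def intro: measurable_sets)
  then show ?thesis
    unfolding escape_set_def by (intro sets.finite_UN) auto
qed

text \<open>Representatives of the hole agree with their coded counterpart only almost everywhere. Since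
  the dynamics preserves the measure, this persists along whole orbits, so that the exceptional
  sets of the countably many times together still form a null set.\<close>

lemma has_escape_rate_conjugacy:
  assumes conj: "metric_conjugacy M S N T \<pi>"
    and hole: "corresponds_under \<pi> M N H A"
    and rate: "has_escape_rate M S H r"
  shows "has_escape_rate N T A r"
proof -
  have S: "measure_preserving M M S" and T: "measure_preserving N N T"
    and \<pi>: "\<pi> \<in> M \<rightarrow>\<^sub>M N" "distr M N \<pi> = N"
    using conj by (auto simp: metric_conjugacy_def measure_preserving_def)
  obtain X where X: "X \<in> sets M" "emeasure M (space M - X) = 0" "S ` X \<subseteq> X"
    and equiv: "\<And>x. x \<in> X \<Longrightarrow> \<pi> (S x) = T (\<pi> x)"
    using conj by (auto simp: metric_conjugacy_def)
  have H: "H \<in> sets M" and A: "A \<in> sets N" and HA: "AE x in M. x \<in> H \<longleftrightarrow> \<pi> x \<in> A"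
    using hole by (auto simp: corresponds_under_def)
  have X_AE: "AE x in M. x \<in> X"
    using X(1,2) by (auto intro!: AE_I[of _ _ "space M - X"])
  have orbit: "(S ^^ j) x \<in> X \<and> \<pi> ((S ^^ j) x) = (T ^^ j) (\<pi> x)" if "x \<in> X" for x j
    using that X(3) equiv by (induction j) auto
  have "AE x in M. (S ^^ j) x \<in> H \<longleftrightarrow> \<pi> ((S ^^ j) x) \<in> A" for j
  proof -
    have Sj: "S ^^ j \<in> M \<rightarrow>\<^sub>M M" "distr M M (S ^^ j) = M"
      using measure_preserving_funpow[OF S] by (auto simp: measure_preserving_def)
    show ?thesis
      by (rule AE_distrD[OF Sj(1)]) (unfold Sj(2), rule HA)
  qed
  then have "AE x in M. \<forall>j. (S ^^ j) x \<in> H \<longleftrightarrow> \<pi> ((S ^^ j) x) \<in> A"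
    by (simp add: AE_all_countable)
  then have orbits: "AE x in M. \<forall>j. (S ^^ j) x \<in> H \<longleftrightarrow> (T ^^ j) (\<pi> x) \<in> A"
    using X_AE by eventually_elim (simp add: orbit)
  have pull: "measure N B = measure M (\<pi> -` B \<inter> space M)" if "B \<in> sets N" for B
    using measure_distr[OF \<pi>(1) that] \<pi>(2) by simp
  have "measure N (space N - escape_set N T A h) = measure M (space M - escape_set M S H h)" for h
  proof -
    have sets: "space N - escape_set N T A h \<in> sets N"
      using escape_set_measurable[OF T A] by auto
    have "measure M (\<pi> -` (space N - escape_set N T A h) \<inter> space M)
            = measure M (space M - escape_set M S H h)"
    proof (rule measure_eq_AE)
      show "AE x in M. x \<in> \<pi> -` (space N - escape_set N T A h) \<inter> space M
              \<longleftrightarrow> x \<in> space M - escape_set M S H h"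
        using orbits AE_space
        by eventually_elim (use \<pi>(1) in \<open>auto simp: escape_set_def measurable_space\<close>)
    qed (use sets \<pi>(1) escape_set_measurable[OF S H] in \<open>auto intro: measurable_sets\<close>)
    then show ?thesis
      by (simp add: pull[OF sets])
  qed
  moreover have "measure N A = measure M H"
    unfolding pull[OF A]
    by (rule measure_eq_AE) (use HA AE_space A H \<pi>(1) in \<open>auto intro: measurable_sets\<close>)
  ultimately show ?thesis
    using rate A by (simp add: has_escape_rate_def)
qed

section \<open>Words that avoid a set of non-overlapping words\<close>

lemma coeff_correlation_poly:
  assumes "l < length u"
  shows "coeff (correlation_poly u w) (length u - 1 - l) = (if overlap_agrees u w l then 1 else 0)"
proof -
  have "length u - 1 - i = length u - 1 - l \<longleftrightarrow> i = l" if "i < length u" for i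
    using that assms by auto
  then have "coeff (correlation_poly u w) (length u - 1 - l)
      = (\<Sum>i<length u. if i = l then (if overlap_agrees u w l then 1 else 0) else 0)"
    unfolding correlation_poly_def coeff_sum by (intro sum.cong) auto
  then show ?thesis
    using assms by simp
qed

text \<open>The only coefficient that property (P) allows to be nonzero belongs to the shift \<open>0\<close> of a
  word against itself.\<close>

lemma property_P_no_overlap:
  assumes "property_P k W" "u \<in> W" "w \<in> W" "0 < l" "l < k"
  shows "\<not> overlap_agrees u w l"
proof -
  have "length u = k"
    and "correlation_poly u w = (if u = w then monom 1 (k - 1) else 0)"
    using assms(1-3) by (auto simp: property_P_def)
  then have "coeff (correlation_poly u w) (length u - 1 - l) = 0"
    using assms(4,5) by auto
  then show ?thesis
    using coeff_correlation_poly[of l u w] assms(5) \<open>length u = k\<close> by auto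
qed

definition avoiding :: "'a set \<Rightarrow> nat \<Rightarrow> 'a list set \<Rightarrow> nat \<Rightarrow> 'a list set" where
  "avoiding L k W n =
     {u \<in> lists L. length u = n \<and> (\<forall>i. i + k \<le> n \<longrightarrow> take k (drop i u) \<notin> W)}"

lemma finite_avoiding: "finite L \<Longrightarrow> finite (avoiding L k W n)"
  by (rule finite_subset[OF _ finite_lists_length_eq[of L n]]) (auto simp: avoiding_def)

lemma card_avoiding_short:
  assumes "n < k" "finite L"
  shows "card (avoiding L k W n) = card L ^ n"
proof -
  have "avoiding L k W n = {u. set u \<subseteq> L \<and> length u = n}"
    using assms(1) by (auto simp: avoiding_def)
  then show ?thesis
    by (simp add: card_lists_length_eq[OF assms(2)])
qed

text \<open>Extend an avoiding word by one letter. Either the result still avoids \<open>W\<close>, or it ends in a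
  word of \<open>W\<close>, and stripping that word leaves an avoiding word. Conversely, a word of \<open>W\<close> may be
  appended to any avoiding word \<open>v\<close>: a further occurrence starting in \<open>v\<close> would overlap the new one,
  so only dropping the last letter is necessary to avoid \<open>W\<close> again.\<close>

lemma avoiding_extension:
  assumes P: "property_P (Suc r) W" and W: "W \<subseteq> lists L"
  shows "(\<lambda>(u, x). u @ [x]) ` (avoiding L (Suc r) W (n + r) \<times> L)
           = avoiding L (Suc r) W (n + Suc r)
             \<union> (\<lambda>(v, w). v @ w) ` (avoiding L (Suc r) W n \<times> W)"
    (is "?E = ?B \<union> ?C")
proof (intro equalityI subsetI)
  fix y assume "y \<in> ?E"
  then obtain u x where y: "y = u @ [x]" and u: "u \<in> avoiding L (Suc r) W (n + r)" and x: "x \<in> L"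
    by auto
  have len: "length u = n + r" and uL: "u \<in> lists L"
    and no: "\<And>i. i + Suc r \<le> n + r \<Longrightarrow> take (Suc r) (drop i u) \<notin> W"
    using u by (auto simp: avoiding_def)
  have same: "take (Suc r) (drop i y) = take (Suc r) (drop i u)" if "i + Suc r \<le> n + r" for i
    using that len by (simp add: y)
  show "y \<in> ?B \<union> ?C"
  proof (cases "drop n y \<in> W")
    case True
    have "take (Suc r) (drop i (take n y)) \<notin> W" if "i + Suc r \<le> n" for i
    proof -
      have "take (Suc r) (drop i (take n y)) = take (Suc r) (drop i y)"
        using that by (simp add: drop_take)
      then show ?thesis
        using no[of i] same[of i] that by simp
    qed
    moreover have "take n y \<in> lists L"
      using uL x by (auto simp: y dest: in_set_takeD)
    ultimately have "take n y \<in> avoiding L (Suc r) W n"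
      using len by (simp add: avoiding_def y)
    then have "(\<lambda>(v, w). v @ w) (take n y, drop n y) \<in> ?C"
      using True by (intro imageI) simp
    then show ?thesis
      by simp
  next
    case False
    have "take (Suc r) (drop i y) \<notin> W" if "i + Suc r \<le> n + Suc r" for i
    proof (cases "i = n")
      case True
      then show ?thesis
        using False len by (simp add: y)
    next
      case False
      then show ?thesis
        using that no[of i] same[of i] by simp
    qed
    then have "y \<in> ?B"
      using uL x len by (auto simp: avoiding_def y)
    then show ?thesis
      by simp
  qed
next
  fix y assume "y \<in> ?B \<union> ?C"
  then have y: "y \<in> lists L" "length y = n + Suc r"
    and no: "\<And>i. i + Suc r \<le> n + r \<Longrightarrow> take (Suc r) (drop i y) \<notin> W"
  proof -
    have "y \<in> lists L \<and> length y = n + Suc r \<and>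
          (\<forall>i. i + Suc r \<le> n + r \<longrightarrow> take (Suc r) (drop i y) \<notin> W)"
    proof (cases "y \<in> ?B")
      case True
      then show ?thesis
        by (auto simp: avoiding_def)
    next
      case False
      then obtain v w where y: "y = v @ w" and v: "v \<in> avoiding L (Suc r) W n" and w: "w \<in> W"
        using \<open>y \<in> ?B \<union> ?C\<close> by auto
      have lens: "length v = n" "length w = Suc r"
        using v w P by (auto simp: avoiding_def property_P_def)
      have "take (Suc r) (drop i y) \<notin> W" if i: "i + Suc r \<le> n + r" for i
      proof (cases "i + Suc r \<le> n")
        case True
        then have "take (Suc r) (drop i y) = take (Suc r) (drop i v)"
          by (simp add: y lens)
        then show ?thesis
          using v True by (simp add: avoiding_def)
      next
        case False
        \<comment> \<open>This occurrence starts in \<open>v\<close> and ends strictly inside \<open>w\<close>.\<close>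
        have "overlap_agrees (take (Suc r) (drop i y)) w (n - i)"
          using i lens unfolding overlap_agrees_def
          by (auto simp: y nth_append)
        then show ?thesis
          using property_P_no_overlap[OF P _ w, of _ "n - i"] False i by auto
      qed
      then show ?thesis
        using v w W lens by (auto simp: avoiding_def y)
    qed
    then show "y \<in> lists L" "length y = n + Suc r"
      "\<And>i. i + Suc r \<le> n + r \<Longrightarrow> take (Suc r) (drop i y) \<notin> W"
      by auto
  qed
  obtain u x where ux: "y = u @ [x]"
    using y(2) by (cases y rule: rev_cases) auto
  have "take (Suc r) (drop i u) \<notin> W" if "i + Suc r \<le> n + r" for i
    using no[OF that] that y(2) by (simp add: ux)
  then have "u \<in> avoiding L (Suc r) W (n + r)" "x \<in> L"
    using y by (auto simp: avoiding_def ux)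
  then have "(\<lambda>(u, x). u @ [x]) (u, x) \<in> ?E"
    by (intro imageI) simp
  then show "y \<in> ?E"
    by (simp add: ux)
qed

lemma card_avoiding_recurrence:
  assumes L: "finite L" and P: "property_P (Suc r) W" and W: "W \<subseteq> lists L" "finite W"
  shows "card (avoiding L (Suc r) W (n + Suc r)) + card (avoiding L (Suc r) W n) * card W
           = card (avoiding L (Suc r) W (n + r)) * card L"
proof -
  let ?B = "avoiding L (Suc r) W (n + Suc r)"
  let ?C = "(\<lambda>(v, w). v @ w) ` (avoiding L (Suc r) W n \<times> W)"
  have len: "length w = Suc r" if "w \<in> W" for w
    using P that by (simp add: property_P_def)
  have "?B \<inter> ?C = {}"
  proof -
    have False if "v @ w \<in> ?B" "v \<in> avoiding L (Suc r) W n" "w \<in> W" for v w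
    proof -
      have "take (Suc r) (drop n (v @ w)) \<notin> W"
        using that(1) by (simp add: avoiding_def)
      moreover have "length v = n"
        using that(2) by (simp add: avoiding_def)
      ultimately show False
        using that(3) len by simp
    qed
    then show ?thesis
      by auto
  qed
  moreover have "inj_on (\<lambda>(v, w). v @ w) (avoiding L (Suc r) W n \<times> W)"
    using len by (auto simp: inj_on_def avoiding_def)
  moreover have "inj_on (\<lambda>(u, x). u @ [x]) (avoiding L (Suc r) W (n + r) \<times> L)"
    by (auto simp: inj_on_def)
  moreover have "finite ?B" "finite ?C"
    using L W(2) by (auto intro!: finite_imageI finite_cartesian_product simp: finite_avoiding)
  ultimately show ?thesis
    using arg_cong[OF avoiding_extension[OF P W(1), of n], of card]
    by (simp add: card_Un_disjoint card_image card_cartesian_product)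
qed

section \<open>Survival probabilities in the full shift\<close>

lemma prob_space_full_shift:
  assumes "q \<ge> 1"
  shows "prob_space (full_shift q)"
  unfolding full_shift_def
  by (intro prob_space_PiM prob_space_uniform_count_measure)
     (use assms in \<open>auto simp: lessThan_empty_iff\<close>)

lemma cylinder_measurable: "cylinder q w \<in> sets (full_shift q)"
proof -
  have [measurable]: "(\<lambda>s. s i) \<in> full_shift q \<rightarrow>\<^sub>M count_space UNIV" for i
  proof (rule measurable_compose)
    show "(\<lambda>s. s i) \<in> full_shift q \<rightarrow>\<^sub>M uniform_count_measure {..<q}"
      unfolding full_shift_def by (rule measurable_component_singleton) simp
    show "(\<lambda>x. x) \<in> uniform_count_measure {..<q} \<rightarrow>\<^sub>M count_space UNIV"
      by (auto simp: measurable_def sets_uniform_count_measure space_uniform_count_measure)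
  qed
  have "cylinder q w = {s \<in> space (full_shift q). \<forall>i<length w. s i = w ! i}"
    by (auto simp: cylinder_def space_full_shift)
  also have "\<dots> \<in> sets (full_shift q)"
    by measurable
  finally show ?thesis .
qed

lemma cylinder_eq_prefix:
  "cylinder q w = {s \<in> space (full_shift q). map s [0..<length w] = w}"
proof -
  have "map s [0..<length w] = w \<longleftrightarrow> (\<forall>i<length w. s i = w ! i)" for s
    by (subst list_eq_iff_nth_eq) simp
  then show ?thesis
    by (simp add: cylinder_def space_full_shift)
qed

lemma measure_prefix:
  assumes q: "q \<ge> 1" and B: "B \<subseteq> lists {..<q}" "\<And>u. u \<in> B \<Longrightarrow> length u = h"
  shows "measure (full_shift q) {s \<in> space (full_shift q). map s [0..<h] \<in> B}
           = real (card B) / real q ^ h"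
proof -
  interpret prob_space "full_shift q"
    by (rule prob_space_full_shift[OF q])
  have cyl: "cylinder q u = {s \<in> space (full_shift q). map s [0..<h] = u}" if "u \<in> B" for u
    using B(2)[OF that] cylinder_eq_prefix[of q u] by simp
  have "finite B"
    by (rule finite_subset[OF _ finite_lists_length_eq[of "{..<q}" h]]) (use B in auto)
  moreover have "disjoint_family_on (cylinder q) B"
    unfolding disjoint_family_on_def using cyl by auto
  ultimately have "prob (\<Union>u\<in>B. cylinder q u) = (\<Sum>u\<in>B. prob (cylinder q u))"
    by (intro finite_measure_finite_Union) (auto simp: cylinder_measurable)
  also have "\<dots> = (\<Sum>u\<in>B. 1 / real q ^ h)"
  proof (rule sum.cong)
    show "prob (cylinder q u) = 1 / real q ^ h" if "u \<in> B" for u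
      using measure_cylinder[OF q, of u] B that by fastforce
  qed simp
  also have "(\<Union>u\<in>B. cylinder q u) = {s \<in> space (full_shift q). map s [0..<h] \<in> B}"
    using cyl by auto
  finally show ?thesis
    by simp
qed

lemma left_shift_funpow: "(left_shift ^^ j) s = (\<lambda>i. s (i + j))"
  by (induction j arbitrary: s) (auto simp: left_shift_def)

text \<open>A visit to the hole at time \<open>h\<close> is decided by the symbols up to position \<open>h + k - 1\<close>, so
  surviving the times \<open>0, \<dots>, h\<close> is a condition on the prefix of length \<open>h + k\<close>.\<close>

lemma survivors_eq_avoiding_prefix:
  assumes W: "W \<subseteq> lists {..<q}" "\<And>w. w \<in> W \<Longrightarrow> length w = k"
  shows "space (full_shift q) - escape_set (full_shift q) left_shift (\<Union>w\<in>W. cylinder q w) h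
           = {s \<in> space (full_shift q). map s [0..<h + k] \<in> avoiding {..<q} k W (h + k)}"
proof -
  have hit: "(left_shift ^^ j) s \<in> (\<Union>w\<in>W. cylinder q w) \<longleftrightarrow>
             take k (drop j (map s [0..<h + k])) \<in> W"
    if s: "s \<in> space (full_shift q)" and j: "j \<le> h" for s j
  proof -
    have block: "take k (drop j (map s [0..<h + k])) = map ((left_shift ^^ j) s) [0..<k]"
      by (rule nth_equalityI) (use j in \<open>auto simp: left_shift_funpow add.commute\<close>)
    have "(left_shift ^^ j) s \<in> space (full_shift q)"
      using s by (simp add: left_shift_funpow space_full_shift)
    then have "(left_shift ^^ j) s \<in> cylinder q w \<longleftrightarrow> map ((left_shift ^^ j) s) [0..<k] = w"
      if "w \<in> W" for w
      using cylinder_eq_prefix[of q w] W(2)[OF that] by simp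
    then show ?thesis
      unfolding block by blast
  qed
  have letters: "map s [0..<h + k] \<in> lists {..<q}" if "s \<in> space (full_shift q)" for s
    using that by (auto simp: space_full_shift)
  have "s \<in> space (full_shift q) - escape_set (full_shift q) left_shift (\<Union>w\<in>W. cylinder q w) h
          \<longleftrightarrow> map s [0..<h + k] \<in> avoiding {..<q} k W (h + k)"
    if s: "s \<in> space (full_shift q)" for s
  proof -
    have "s \<in> space (full_shift q) - escape_set (full_shift q) left_shift (\<Union>w\<in>W. cylinder q w) h
            \<longleftrightarrow> (\<forall>j\<le>h. (left_shift ^^ j) s \<notin> (\<Union>w\<in>W. cylinder q w))"
      using s unfolding escape_set_def by blast
    also have "\<dots> \<longleftrightarrow> (\<forall>j\<le>h. take k (drop j (map s [0..<h + k])) \<notin> W)"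
      using hit[OF s] by blast
    also have "\<dots> \<longleftrightarrow> map s [0..<h + k] \<in> avoiding {..<q} k W (h + k)"
      unfolding avoiding_def using letters[OF s] by simp
    finally show ?thesis .
  qed
  then show ?thesis
    by blast
qed

section \<open>Exponential rate of the recurrence\<close>

text \<open>The critical point of \<open>t ^ r * (1 - t)\<close> is \<open>r / Suc r\<close>.\<close>

lemma deriv_power_times_one_minus:
  fixes t :: real
  shows "DERIV (\<lambda>t. t ^ Suc k * (1 - t)) t :> t ^ k * (real (Suc k) - t * real (Suc (Suc k)))"
proof -
  have "DERIV (\<lambda>t. t ^ Suc k * (1 - t)) t :> real (Suc k) * t ^ k * (1 - t) + (0 - 1) * t ^ Suc k"
    using DERIV_mult[OF DERIV_pow[of "Suc k" t UNIV] DERIV_diff[OF DERIV_const DERIV_ident]]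
    by simp
  then show ?thesis
    by (simp add: algebra_simps)
qed

lemma power_times_one_minus_mono:
  fixes x y :: real
  assumes "0 \<le> x" "x \<le> y" "y \<le> real r / real (Suc r)"
  shows "x ^ r * (1 - x) \<le> y ^ r * (1 - y)"
proof (cases r)
  case 0
  then show ?thesis
    using assms by simp
next
  case (Suc k)
  show ?thesis
    unfolding Suc
  proof (rule DERIV_nonneg_imp_nondecreasing[OF assms(2)], intro exI conjI)
    fix t assume t: "x \<le> t" "t \<le> y"
    show "DERIV (\<lambda>t. t ^ Suc k * (1 - t)) t :> t ^ k * (real (Suc k) - t * real (Suc (Suc k)))"
      by (rule deriv_power_times_one_minus)
    have "t \<le> real (Suc k) / real (Suc (Suc k))"
      using t(2) assms(3) unfolding Suc by linarith
    then have "t * real (Suc (Suc k)) \<le> real (Suc k)"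
      by (simp only: pos_le_divide_eq of_nat_0_less_iff zero_less_Suc)
    then show "0 \<le> t ^ k * (real (Suc k) - t * real (Suc (Suc k)))"
      using t(1) assms(1) by (intro mult_nonneg_nonneg) auto
  qed
qed

lemma power_times_one_minus_antimono:
  fixes x y :: real
  assumes "real r / real (Suc r) \<le> x" "x \<le> y"
  shows "y ^ r * (1 - y) \<le> x ^ r * (1 - x)"
proof (cases r)
  case 0
  then show ?thesis
    using assms by simp
next
  case (Suc k)
  show ?thesis
    unfolding Suc
  proof (rule DERIV_nonpos_imp_nonincreasing[OF assms(2)], intro exI conjI)
    fix t assume t: "x \<le> t" "t \<le> y"
    show "DERIV (\<lambda>t. t ^ Suc k * (1 - t)) t :> t ^ k * (real (Suc k) - t * real (Suc (Suc k)))"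
      by (rule deriv_power_times_one_minus)
    have crit: "real (Suc k) / real (Suc (Suc k)) \<le> t"
      using t(1) assms(1) unfolding Suc by linarith
    then have "real (Suc k) \<le> t * real (Suc (Suc k))"
      by (simp only: pos_divide_le_eq of_nat_0_less_iff zero_less_Suc)
    moreover have "0 \<le> t"
      by (rule order_trans[OF _ crit]) simp
    ultimately show "t ^ k * (real (Suc k) - t * real (Suc (Suc k))) \<le> 0"
      by (intro mult_nonneg_nonpos) auto
  qed
qed

locale renewal_recurrence =
  fixes p :: "nat \<Rightarrow> real" and r :: nat and t :: real
  assumes initial: "\<And>h. h \<le> r \<Longrightarrow> p h = 1"
    and step: "\<And>h. p (h + Suc r) = p (h + r) - t ^ r * (1 - t) * p h"
    and root: "0 < t" "t < 1"
begin

text \<open>If \<open>p\<close> shrinks by at most the factor \<open>t\<close> per step so far, then \<open>t ^ r * p h \<le> p (h + r)\<close>, and the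
  recurrence loses at most the fraction \<open>1 - t\<close> in the next step.\<close>

lemma ratio_lower: "0 < p h \<and> t * p h \<le> p (Suc h)"
proof (induction h rule: less_induct)
  case (less h)
  have power: "t ^ j * p i \<le> p (i + j)" if "i + j \<le> h" for i j
    using that
  proof (induction j)
    case (Suc j)
    have "t ^ Suc j * p i \<le> t * p (i + j)"
      using Suc root by (simp add: mult.assoc)
    also have "\<dots> \<le> p (Suc (i + j))"
      using Suc.prems less by simp
    finally show ?case
      by simp
  qed simp
  have "t ^ h * p 0 \<le> p h"
    using power[of 0 h] by simp
  then have pos: "0 < p h"
    using zero_less_power[OF root(1), of h] initial[of 0] by simp
  show ?case
  proof (cases "Suc h \<le> r")
    case True
    then show ?thesis
      using initial root by simp
  next
    case False
    then obtain i where h: "h = i + r"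
      by (metis add.commute le_add_diff_inverse not_less_eq_eq)
    have "(1 - t) * (t ^ r * p i) \<le> (1 - t) * p h"
      using power[of i r] h root by (intro mult_left_mono) auto
    then have "t * p h \<le> p (Suc h)"
      using step[of i] by (simp add: h algebra_simps)
    with pos show ?thesis
      by simp
  qed
qed

lemma power_ratio: "t ^ j * p i \<le> p (i + j)"
proof (induction j)
  case (Suc j)
  have "t ^ Suc j * p i \<le> t * p (i + j)"
    using Suc root by (simp add: mult.assoc)
  also have "\<dots> \<le> p (Suc (i + j))"
    using ratio_lower by blast
  finally show ?case
    by simp
qed simp

lemma recurrence_lower: "t ^ h \<le> p h"
  using power_ratio[of h 0] initial[of 0] by simp

text \<open>Dividing the characteristic polynomial by its root \<open>t\<close> leaves a linear combination of \<open>r + 1\<close>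
  consecutive values that is multiplied by exactly \<open>t\<close> in each step.\<close>

lemma first_order_relation:
  "p (h + r) - (1 - t) * (\<Sum>i<r. t ^ (r - Suc i) * p (h + i)) = t ^ (h + r)"
proof (induction h)
  case 0
  have "(1 - t) * (\<Sum>i<r. t ^ (r - Suc i)) = 1 - t ^ r"
    by (simp add: sum.nat_diff_reindex one_diff_power_eq)
  then show ?case
    using initial by simp
next
  case (Suc h)
  have "(\<Sum>i<r. t ^ (r - Suc i) * p (Suc h + i)) - t * (\<Sum>i<r. t ^ (r - Suc i) * p (h + i))
      = (\<Sum>i<r. t ^ (r - Suc i) * p (h + Suc i) - t ^ (r - i) * p (h + i))"
    unfolding sum_distrib_left sum_subtractf[symmetric]
    by (intro sum.cong) (auto simp: mult.assoc[symmetric] simp flip: power_Suc simp: Suc_diff_Suc)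
  also have "\<dots> = p (h + r) - t ^ r * p h"
    using sum_lessThan_telescope[of "\<lambda>i. t ^ (r - i) * p (h + i)" r] by simp
  finally have tele: "(\<Sum>i<r. t ^ (r - Suc i) * p (Suc h + i))
      = t * (\<Sum>i<r. t ^ (r - Suc i) * p (h + i)) + (p (h + r) - t ^ r * p h)"
    by simp
  have "p (Suc h + r) - (1 - t) * (\<Sum>i<r. t ^ (r - Suc i) * p (Suc h + i))
      = t * (p (h + r) - (1 - t) * (\<Sum>i<r. t ^ (r - Suc i) * p (h + i)))"
    using step[of h] unfolding tele by (simp add: algebra_simps)
  then show ?case
    using Suc by simp
qed

text \<open>Each of the \<open>r\<close> terms subtracted in \<open>first_order_relation\<close> is at most \<open>p (h + r) / t\<close>. What
  remains is a positive multiple of \<open>p (h + r)\<close> because \<open>t\<close> lies to the right of the critical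
  point.\<close>

lemma recurrence_upper:
  assumes "real r / real (Suc r) < t"
  shows "p (h + r) \<le> t / (t - (1 - t) * real r) * t ^ (h + r)"
proof -
  have pos: "0 < t - (1 - t) * real r"
    using assms by (simp add: pos_divide_less_eq algebra_simps)
  have "t * (t ^ (r - Suc i) * p (h + i)) \<le> p (h + r)" if "i < r" for i
    using power_ratio[of "r - i" "h + i"] that
    by (simp add: mult.assoc[symmetric] Suc_diff_Suc flip: power_Suc)
  then have "(\<Sum>i<r. t * (t ^ (r - Suc i) * p (h + i))) \<le> real r * p (h + r)"
    using sum_bounded_above[of "{..<r}" _ "p (h + r)"] by simp
  then have "(1 - t) * (\<Sum>i<r. t * (t ^ (r - Suc i) * p (h + i))) \<le> (1 - t) * (real r * p (h + r))"
    using root by (intro mult_left_mono) auto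
  moreover have "t * t ^ (h + r)
      = t * p (h + r) - (1 - t) * (\<Sum>i<r. t * (t ^ (r - Suc i) * p (h + i)))"
    unfolding first_order_relation[symmetric] sum_distrib_left[symmetric]
    by (simp add: algebra_simps)
  ultimately have "p (h + r) * (t - (1 - t) * real r) \<le> t * t ^ (h + r)"
    by (simp add: algebra_simps)
  then show ?thesis
    using pos by (simp add: pos_le_divide_eq)
qed

lemma exponential_rate:
  assumes "real r / real (Suc r) < t"
  shows "(\<lambda>h. - (ln (p (h + Suc r)) / real h)) \<longlonglongrightarrow> - ln t"
proof -
  define C where "C = t / (t - (1 - t) * real r)"
  have C: "0 < C"
    using assms root by (simp add: C_def pos_divide_less_eq algebra_simps)
  have low: "real (h + Suc r) * ln t \<le> ln (p (h + Suc r))" for h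
  proof -
    have "ln (t ^ (h + Suc r)) \<le> ln (p (h + Suc r))"
      using root by (intro ln_mono recurrence_lower) simp_all
    then show ?thesis
      using root by (simp add: ln_realpow del: power_Suc)
  qed
  have up: "ln (p (h + Suc r)) \<le> ln C + real (h + Suc r) * ln t" for h
  proof -
    have "ln (p (h + Suc r)) \<le> ln (C * t ^ (h + Suc r))"
      using recurrence_upper[OF assms, of "Suc h"] C root ratio_lower[of "h + Suc r"]
      by (intro ln_mono) (auto simp: C_def simp del: power_Suc)
    then show ?thesis
      using root C by (simp add: ln_mult ln_realpow del: power_Suc)
  qed
  \<comment> \<open>Neither the constant \<open>C\<close> nor the index shift by \<open>Suc r\<close> affects the rate.\<close>
  have lim: "(\<lambda>h. - ((c + real (h + Suc r) * ln t) / real h)) \<longlonglongrightarrow> - ln t" for c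
  proof -
    have "(\<lambda>h. - ((c + real (Suc r) * ln t) * (1 / real h)) - ln t) \<longlonglongrightarrow>
            - ((c + real (Suc r) * ln t) * 0) - ln t"
      by (intro tendsto_intros lim_1_over_n)
    moreover have "\<forall>\<^sub>F h in sequentially. - ((c + real (Suc r) * ln t) * (1 / real h)) - ln t
        = - ((c + real (h + Suc r) * ln t) / real h)"
      using eventually_gt_at_top[of 0] by eventually_elim (simp add: field_simps)
    ultimately show ?thesis
      by (simp add: tendsto_cong)
  qed
  show ?thesis
  proof (rule tendsto_sandwich[OF _ _ lim[of "ln C"] lim[of 0]])
    show "\<forall>\<^sub>F h in sequentially.
        - ((ln C + real (h + Suc r) * ln t) / real h) \<le> - (ln (p (h + Suc r)) / real h)"
      using up by (intro always_eventually) (auto intro: divide_right_mono)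
    show "\<forall>\<^sub>F h in sequentially.
        - (ln (p (h + Suc r)) / real h) \<le> - ((0 + real (h + Suc r) * ln t) / real h)"
      using low by (intro always_eventually) (auto intro: divide_right_mono)
  qed
qed

end

text \<open>Dividing \<open>card_avoiding_recurrence\<close> by \<open>q ^ (h + Suc r)\<close> turns it into a
  \<open>renewal_recurrence\<close> for the survival probabilities, whose coefficient \<open>t ^ r * (1 - t)\<close> is the
  measure of the hole.\<close>

theorem escape_rate_full_shift:
  fixes q r :: nat and t :: real
  assumes q: "q \<ge> 1" and W: "W \<subseteq> lists {..<q}" "property_P (Suc r) W" "W \<noteq> {}"
    and t: "t < 1" "real r / real (Suc r) < t"
      "t ^ r * (1 - t) = real (card W) / real q ^ Suc r"
  shows "has_escape_rate (full_shift q) left_shift (\<Union>w\<in>W. cylinder q w) (- ln t)"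
proof -
  interpret prob_space "full_shift q"
    by (rule prob_space_full_shift[OF q])
  define p where "p h = real (card (avoiding {..<q} (Suc r) W h)) / real q ^ h" for h
  have len: "length w = Suc r" if "w \<in> W" for w
    using W(2) that by (simp add: property_P_def)
  have "finite W"
    by (rule finite_subset[OF _ finite_lists_length_eq[of "{..<q}" "Suc r"]])
       (use W(1) len in auto)
  have "0 \<le> real r / real (Suc r)"
    by simp
  then have "0 < t"
    using t(2) by linarith
  interpret renewal_recurrence p r t
  proof
    show "p h = 1" if "h \<le> r" for h
      using that q by (simp add: p_def card_avoiding_short)
    show "p (h + Suc r) = p (h + r) - t ^ r * (1 - t) * p h" for h
    proof -
      have "real (card (avoiding {..<q} (Suc r) W (h + Suc r)))
          = real (card (avoiding {..<q} (Suc r) W (h + r))) * real q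
            - real (card (avoiding {..<q} (Suc r) W h)) * real (card W)"
        using arg_cong[OF card_avoiding_recurrence[OF _ W(2,1) \<open>finite W\<close>, of h], of real]
        by (simp del: add_Suc_right)
      then show ?thesis
        using q unfolding p_def t(3) by (simp add: field_simps power_add)
    qed
  qed (use \<open>0 < t\<close> t(1) in auto)
  have survive: "prob (space (full_shift q)
      - escape_set (full_shift q) left_shift (\<Union>w\<in>W. cylinder q w) h) = p (h + Suc r)" for h
  proof -
    have "space (full_shift q) - escape_set (full_shift q) left_shift (\<Union>w\<in>W. cylinder q w) h
        = {s \<in> space (full_shift q).
             map s [0..<h + Suc r] \<in> avoiding {..<q} (Suc r) W (h + Suc r)}"
      using W(1) len by (rule survivors_eq_avoiding_prefix)
    moreover have "prob {s \<in> space (full_shift q).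
        map s [0..<h + Suc r] \<in> avoiding {..<q} (Suc r) W (h + Suc r)} = p (h + Suc r)"
      unfolding p_def by (rule measure_prefix[OF q]) (auto simp: avoiding_def)
    ultimately show ?thesis
      by simp
  qed
  have sets: "(\<Union>w\<in>W. cylinder q w) \<in> sets (full_shift q)"
    using \<open>finite W\<close> cylinder_measurable by auto
  obtain w where w: "w \<in> W"
    using W(3) by auto
  have "set w \<subseteq> {..<q}"
    using W(1) w by auto
  then have "0 < prob (cylinder q w)"
    using measure_cylinder[OF q, of w] q by simp
  also have "\<dots> \<le> prob (\<Union>w\<in>W. cylinder q w)"
    using w sets by (intro finite_measure_mono) auto
  finally show ?thesis
    using sets survive ratio_lower exponential_rate[OF t(2)]
    by (simp add: has_escape_rate_def)
qed

section \<open>Comparison of the two roots\<close>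

text \<open>Multiplied by \<open>ln q - ln (q - 1)\<close>, the bound on \<open>m\<close> becomes
  \<open>- n * ln q < m * ln ((q - 1) / q) - ln q\<close>. In exponential form it compares \<open>1 / q ^ n\<close>
  with \<open>t ^ m * (1 - t)\<close> at \<open>t = 1 - 1 / q\<close>.\<close>

lemma length_bound_iff:
  fixes q m n :: nat
  assumes q: "q \<ge> 2" and n: "n \<ge> 1"
  shows "real m < (real n - 1) + (real n - 1) * ln (real q - 1) / (ln (real q) - ln (real q - 1))
           \<longleftrightarrow> 1 / real q ^ n < (1 - 1 / real q) ^ m * (1 / real q)"
proof -
  have d: "0 < ln (real q) - ln (real q - 1)"
    using q by simp
  have "real m < (real n - 1) + (real n - 1) * ln (real q - 1) / (ln (real q) - ln (real q - 1))
      \<longleftrightarrow> real m * (ln (real q) - ln (real q - 1)) < (real n - 1) * ln (real q)"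
    using d by (simp add: field_simps)
  also have "\<dots> \<longleftrightarrow> - (real n * ln (real q)) < real m * (ln (real q - 1) - ln (real q)) - ln (real q)"
    by (simp add: algebra_simps)
  also have "- (real n * ln (real q)) = ln (1 / real q ^ n)"
    using q by (simp add: ln_div ln_realpow)
  also have "real m * (ln (real q - 1) - ln (real q)) - ln (real q)
      = ln ((1 - 1 / real q) ^ m * (1 / real q))"
  proof -
    have "1 - 1 / real q = (real q - 1) / real q"
      using q by (simp add: field_simps)
    then have "ln (1 - 1 / real q) = ln (real q - 1) - ln (real q)" "0 < 1 - 1 / real q"
      using q by (simp_all add: ln_div)
    then show ?thesis
      using q by (simp add: ln_div ln_mult ln_realpow)
  qed
  also have "ln (1 / real q ^ n) < ln ((1 - 1 / real q) ^ m * (1 / real q))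
      \<longleftrightarrow> 1 / real q ^ n < (1 - 1 / real q) ^ m * (1 / real q)"
    using q by (intro ln_less_cancel_iff) auto
  finally show ?thesis .
qed

text \<open>The given point \<open>x\<close> may lie on either side of the maximum. If it lies to the left, the
  maximum itself takes its place, where the value is at least as large; from there to \<open>1\<close> the
  value falls to \<open>0\<close>.\<close>

lemma root_right_of_maximum:
  fixes x c :: real
  assumes x: "0 \<le> x" "x < 1" and c: "0 < c" "c < x ^ r * (1 - x)"
  obtains t where "real r / real (Suc r) < t" "t < 1" "t ^ r * (1 - t) = c"
proof -
  define y where "y = max x (real r / real (Suc r))"
  have "x ^ r * (1 - x) \<le> y ^ r * (1 - y)"
  proof (cases "x \<le> real r / real (Suc r)")
    case True
    then show ?thesis
      using power_times_one_minus_mono[OF x(1), of y r] by (simp add: y_def max_def)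
  next
    case False
    then show ?thesis
      by (simp add: y_def max_def)
  qed
  then have y: "c < y ^ r * (1 - y)"
    using c(2) by linarith
  have "y < 1"
    using x(2) by (simp add: y_def)
  have "\<exists>t\<ge>y. t \<le> 1 \<and> t ^ r * (1 - t) = c"
    by (rule IVT2') (use y c(1) \<open>y < 1\<close> in \<open>auto intro!: continuous_intros\<close>)
  then obtain t where t: "y \<le> t" "t \<le> 1" "t ^ r * (1 - t) = c"
    by auto
  then have "t \<noteq> 1" "t \<noteq> y"
    using c(1) y by auto
  then have "y < t" "t < 1"
    using t by auto
  then show thesis
    using that[of t] t(3) by (simp add: y_def)
qed

text \<open>Since \<open>t' < 1\<close>, the value of \<open>t ^ r * (1 - t)\<close> at \<open>t'\<close> exceeds its value at \<open>t\<close>; this is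
  impossible for \<open>t' \<ge> t\<close>, where the function is already decreasing.\<close>

lemma root_decreasing:
  fixes t t' :: real
  assumes t: "real r / real (Suc r) < t"
    and t': "0 < t'" "t' < 1"
    and eq: "t' ^ Suc r * (1 - t') = t ^ r * (1 - t)"
  shows "t' < t"
proof (rule ccontr)
  assume "\<not> t' < t"
  then have "t' ^ r * (1 - t') \<le> t ^ r * (1 - t)"
    using t by (intro power_times_one_minus_antimono) auto
  also have "\<dots> = t' * (t' ^ r * (1 - t'))"
    using eq by simp
  also have "\<dots> < 1 * (t' ^ r * (1 - t'))"
    using t' by (intro mult_strict_right_mono) auto
  finally show False
    by simp
qed

theorem theorem5p4:
  fixes q m n :: nat
    and a b :: real
    and f :: "'d::finite \<Rightarrow> real \<Rightarrow> real"
    and N :: "'d \<Rightarrow> nat"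
    and P :: "'d \<Rightarrow> nat \<Rightarrow> real set"
    and e :: "nat \<Rightarrow> 'd \<Rightarrow> nat"
    and \<pi> :: "(nat \<Rightarrow> nat) \<Rightarrow> real ^ 'd"
    and W W' :: "nat list set"
    and A A' :: "(real ^ 'd) set"
  assumes q: "q \<ge> 2"
    and markov: "\<And>i. expansive_markov_map a b (N i) (P i) (f i)"
    and labels: "bij_betw e {..<q} (Pi\<^sub>E UNIV (\<lambda>i. {..<N i}))"
    and conj: "conjugate_to_full_shift q (cube a b) (\<lambda>s. product_rectangle P (e s)) (product_map f) \<pi>"
    and n: "n \<ge> 1"
    and m: "n \<le> m"
      "real m < (real n - 1) + (real n - 1) * ln (real q - 1) / (ln (real q) - ln (real q - 1))"
    and W: "W \<subseteq> lists {..<q}" "card W = q ^ (m - n)" "property_P m W"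
    and W': "W' \<subseteq> lists {..<q}" "card W' = q ^ (m + 1 - n)" "property_P (m + 1) W'"
    and A: "corresponds_under \<pi> (full_shift q) (induced_measure q (cube a b) \<pi>)
            (\<Union>w\<in>W. cylinder q w) A"
    and A': "corresponds_under \<pi> (full_shift q) (induced_measure q (cube a b) \<pi>)
            (\<Union>w\<in>W'. cylinder q w) A'"
  shows "\<exists>\<rho> \<rho>'. has_escape_rate (induced_measure q (cube a b) \<pi>) (product_map f) A \<rho> \<and>
                 has_escape_rate (induced_measure q (cube a b) \<pi>) (product_map f) A' \<rho>' \<and>
                 \<rho> < \<rho>'"
proof -
  define c x where "c = 1 / real q ^ n" and "x = 1 - 1 / real q"
  obtain r where r: "m = Suc r"
    using n m(1) by (cases m) auto
  have x: "0 \<le> x" "x < 1" and c: "0 < c"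
    using q by (auto simp: x_def c_def)
  have cm: "c < x ^ m * (1 - x)"
    using m(2) length_bound_iff[OF q n] by (simp add: c_def x_def)
  also have "\<dots> \<le> x ^ r * (1 - x)"
    using x by (intro mult_right_mono power_decreasing) (auto simp: r)
  finally have cr: "c < x ^ r * (1 - x)" .
  obtain t where t: "real r / real (Suc r) < t" "t < 1" "t ^ r * (1 - t) = c"
    using root_right_of_maximum[OF x c cr] .
  obtain t' where t': "real m / real (Suc m) < t'" "t' < 1" "t' ^ m * (1 - t') = c"
    using root_right_of_maximum[OF x c cm] .
  have density: "real (q ^ (k - n)) / real q ^ k = c" if "n \<le> k" for k
  proof -
    have "real q ^ k = real q ^ (k - n) * real q ^ n"
      using that by (simp flip: power_add)
    then show ?thesis
      using q by (simp add: c_def)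
  qed
  have "0 \<le> real r / real (Suc r)" "0 \<le> real m / real (Suc m)"
    by simp_all
  then have "0 < t" "0 < t'"
    using t(1) t'(1) by linarith+
  have "t' < t"
    using root_decreasing[OF t(1) \<open>0 < t'\<close> t'(2)] t(3) t'(3) by (simp add: r)
  then have "- ln t < - ln t'"
    using \<open>0 < t'\<close> \<open>0 < t\<close> by simp
  have conj': "metric_conjugacy (full_shift q) left_shift (induced_measure q (cube a b) \<pi>)
                 (product_map f) \<pi>"
    using conj by (simp add: conjugate_to_full_shift_def)
  have "W \<noteq> {}" "W' \<noteq> {}"
    using W(2) W'(2) q by auto
  have "has_escape_rate (full_shift q) left_shift (\<Union>w\<in>W. cylinder q w) (- ln t)"
  proof (rule escape_rate_full_shift)
    show "t ^ r * (1 - t) = real (card W) / real q ^ Suc r"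
      using density[of m] m(1) t(3) W(2) by (simp add: r)
  qed (use q W t \<open>W \<noteq> {}\<close> in \<open>auto simp: r\<close>)
  moreover have "has_escape_rate (full_shift q) left_shift (\<Union>w\<in>W'. cylinder q w) (- ln t')"
  proof (rule escape_rate_full_shift)
    show "t' ^ m * (1 - t') = real (card W') / real q ^ Suc m"
      using density[of "Suc m"] m(1) t'(3) W'(2) by simp
  qed (use q W' t' \<open>W' \<noteq> {}\<close> in auto)
  ultimately show ?thesis
    using has_escape_rate_conjugacy[OF conj' A] has_escape_rate_conjugacy[OF conj' A']
      \<open>- ln t < - ln t'\<close> by blast
qed

end
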